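(* Let $\lambda\ge 1$, $\mu\ge 0$ and $t\in(1/2,1)$, and let $f(z)=z+\sum_{n=2}^{\infty}a_nz^n$ be a function in the class $\mathscr{B}_{\Sigma}(\lambda,\mu,t)$. Put $$M:=\frac{\left|(1+\lambda+2\mu)^2-4t^{2}\left[(\lambda+2\mu)^2-2\mu\right]\right|}{4(1+2\lambda+6\mu)t^{2}}.$$ Then for every $\eta\in\mathbb{R}$, $$|a_{3}-\eta a_{2}^{2}|\leq \begin{cases}\dfrac{2t}{1+2\lambda+6\mu}, & |\eta-1|\leq M,\\[2ex] \dfrac{8|\eta-1|t^{3}}{\left|(1+\lambda+2\mu)^2-4t^{2}\left[(\lambda+2\mu)^2-2\mu\right]\right|}, & |\eta-1|\geq M,\end{cases}$$ where the second bound is asserted whenever its denominator is nonzero.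
   Context: Let $\mathbb{U}=\{z\in\mathbb{C}:|z|<1\}$, and let $\mathscr{A}$ be the class of functions $f(z)=z+\sum_{n=2}^{\infty}a_nz^n$ analytic in $\mathbb{U}$. A function $f\in\mathscr{A}$ is bi-univalent in $\mathbb{U}$ if both $f$ and $f^{-1}$ are univalent in $\mathbb{U}$; here $f^{-1}$ is the local inverse of $f$ near $0$, $f^{-1}(w)=w-a_2w^2+(2a_2^2-a_3)w^3-\cdots$, which is understood to extend to an analytic univalent function on $\mathbb{U}$ (again denoted $f^{-1}$). $\Sigma$ denotes the class of bi-univalent functions in $\mathscr{A}$. For functions $F,G$ analytic in $\mathbb{U}$, $F$ is subordinate to $G$, written $F(z)\prec G(z)$, if there is an analytic $\omega$ on $\mathbb{U}$ with $\omega(0)=0$, $|\omega(z)|<1$ for all $z\in\mathbb{U}$, and $F(z)=G(\omega(z))$ for all $z\in\mathbb{U}$. Let $H(z,t)=\frac{1}{1-2tz+z^2}$ for $z\in\mathbb{U}$ (the generating function of the Chebyshev polynomials of the second kind). For $\lambda\ge 1$, $\mu\ge 0$, $t\in(1/2,1)$, the class $\mathscr{B}_{\Sigma}(\lambda,\mu,t)$ consists of all $f\in\Sigma$ such that, with $g=f^{-1}$, $$(1-\lambda)\frac{f(z)}{z}+\lambda f'(z)+\mu zf''(z)\prec H(z,t)\quad\text{and}\quad (1-\lambda)\frac{g(w)}{w}+\lambda g'(w)+\mu wg''(w)\prec H(w,t)$$ on $\mathbb{U}$ (the quotients $f(z)/z$ and $g(w)/w$ take the value $1$ at $0$). *)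

theory Defs
  imports "HOL-Complex_Analysis.Complex_Analysis"
begin

abbreviation unit_disk :: "complex set" where
  "unit_disk \<equiv> ball 0 1"

text \<open>The sequence \<open>a\<close> lists the coefficients in f(z) = z + sum over n >= 2 of a(n) z^n;
  the values a(0) and a(1) are irrelevant.\<close>

definition has_normalized_expansion :: "(complex \<Rightarrow> complex) \<Rightarrow> (nat \<Rightarrow> complex) \<Rightarrow> bool" where
  "has_normalized_expansion f a \<longleftrightarrow>
     (\<forall>z\<in>unit_disk. (\<lambda>n. a (n + 2) * z ^ (n + 2)) sums (f z - z))"

definition class_A :: "(complex \<Rightarrow> complex) set" where
  "class_A = {f. f holomorphic_on unit_disk \<and> (\<exists>a. has_normalized_expansion f a)}"

definition univalent :: "(complex \<Rightarrow> complex) \<Rightarrow> bool" where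
  "univalent f \<longleftrightarrow> f holomorphic_on unit_disk \<and> inj_on f unit_disk"

text \<open>\<open>g\<close> is an analytic extension to the unit disk of the local inverse of \<open>f\<close> near 0.
  By the identity theorem \<open>g\<close> is determined on the unit disk by \<open>f\<close>; values outside the
  disk are unconstrained and never used.\<close>

definition inverse_extension :: "(complex \<Rightarrow> complex) \<Rightarrow> (complex \<Rightarrow> complex) \<Rightarrow> bool" where
  "inverse_extension f g \<longleftrightarrow> g holomorphic_on unit_disk \<and>
     (\<exists>V W. open V \<and> 0 \<in> V \<and> V \<subseteq> unit_disk \<and> open W \<and> 0 \<in> W \<and> W \<subseteq> unit_disk \<and>
            homeomorphism V W f g)"

definition class_Sigma :: "(complex \<Rightarrow> complex) set" where
  "class_Sigma = {f \<in> class_A. univalent f \<and> (\<exists>g. inverse_extension f g \<and> univalent g)}"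

definition subordinate :: "(complex \<Rightarrow> complex) \<Rightarrow> (complex \<Rightarrow> complex) \<Rightarrow> bool" where
  "subordinate F G \<longleftrightarrow>
     (\<exists>\<omega>. \<omega> holomorphic_on unit_disk \<and> \<omega> 0 = 0 \<and> (\<forall>z\<in>unit_disk. norm (\<omega> z) < 1) \<and>
          (\<forall>z\<in>unit_disk. F z = G (\<omega> z)))"

definition H :: "complex \<Rightarrow> real \<Rightarrow> complex" where
  "H z t = 1 / (1 - 2 * of_real t * z + z ^ 2)"

definition quotient_id :: "(complex \<Rightarrow> complex) \<Rightarrow> complex \<Rightarrow> complex" where
  "quotient_id f z = (if z = 0 then 1 else f z / z)"

definition B_operator :: "real \<Rightarrow> real \<Rightarrow> (complex \<Rightarrow> complex) \<Rightarrow> complex \<Rightarrow> complex" where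
  "B_operator lam mu f z =
     (1 - of_real lam) * quotient_id f z + of_real lam * deriv f z
       + of_real mu * z * deriv (deriv f) z"

text \<open>The existential over \<open>g\<close> only names the inverse: on the unit disk, to which the
  subordination refers, it is unique.\<close>

definition class_B_Sigma :: "real \<Rightarrow> real \<Rightarrow> real \<Rightarrow> (complex \<Rightarrow> complex) set" where
  "class_B_Sigma lam mu t = {f \<in> class_Sigma. \<exists>g. inverse_extension f g \<and>
     subordinate (B_operator lam mu f) (\<lambda>z. H z t) \<and>
     subordinate (B_operator lam mu g) (\<lambda>w. H w t)}"

end

theory Submission
  imports Defs
begin

text \<open>
  Comparing the coefficients of z and z^2 in the two subordinations gives four equations between
  a(2), a(3) and the first two coefficients of the two Schwarz functions. The first coefficients
  c1, d1 satisfy d1 = - c1 because the inverse of f has second coefficient - a(2). Hence adding the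
  two equations of order 2 expresses a(2)^2 as a multiple of c + d, where c and d are the second
  coefficients of the Schwarz functions, and subtracting them expresses a(3) - a(2)^2 as a multiple
  of c - d. So a(3) - \<eta> a(2)^2 = x (c + d) + y (c - d) with real x and y, and since
  |c|, |d| \<le> 1 by Cauchy's inequality, its modulus is at most |x + y| + |x - y| = 2 max |x| |y|.
\<close>

text \<open>Since \<omega> is controlled only on the open disk, Cauchy's inequality is applied on
  circles of radius \<open>r < 1\<close>. It gives
  \<open>r ^ n * norm (fps_nth W n) \<le> 1\<close>, and letting \<open>r\<close> tend to 1 from the
  left yields the claim.\<close>

lemma bounded_imp_fps_nth_le_1:
  assumes holo: "\<omega> holomorphic_on unit_disk"
    and le_1: "\<And>z. z \<in> unit_disk \<Longrightarrow> norm (\<omega> z) \<le> 1"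
    and exp: "\<omega> has_fps_expansion W"
  shows "norm (fps_nth W n) \<le> 1"
proof (rule tendsto_upperbound)
  have "((\<lambda>r. r ^ n * norm (fps_nth W n)) \<longlongrightarrow> 1 ^ n * norm (fps_nth W n)) (at_left (1::real))"
    by (intro tendsto_intros)
  then show "((\<lambda>r. r ^ n * norm (fps_nth W n)) \<longlongrightarrow> norm (fps_nth W n)) (at_left (1::real))"
    by simp
  have "r ^ n * norm (fps_nth W n) \<le> 1" if "0 < r" "r < 1" for r :: real
  proof -
    have "norm ((deriv ^^ n) \<omega> 0) \<le> fact n * 1 / r ^ n"
    proof (rule Cauchy_inequality)
      show "\<omega> holomorphic_on ball 0 r"
        by (rule holomorphic_on_subset[OF holo]) (use that in auto)
      show "continuous_on (cball 0 r) \<omega>"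
        by (rule continuous_on_subset[OF holomorphic_on_imp_continuous_on[OF holo]]) (use that in auto)
      show "norm (\<omega> z) \<le> 1" if "norm (0 - z) = r" for z
        using le_1[of z] that \<open>r < 1\<close> by simp
    qed fact
    moreover have "fps_nth W n = (deriv ^^ n) \<omega> 0 / fact n"
      using exp by (rule fps_nth_fps_expansion)
    ultimately show ?thesis
      using that by (simp add: norm_divide divide_le_eq pos_le_divide_eq mult.commute)
  qed
  then show "\<forall>\<^sub>F r in at_left 1. r ^ n * norm (fps_nth W n) \<le> 1"
    using eventually_at_left_real[of 0 1] by (auto elim!: eventually_mono)
qed simp

text \<open>Here \<open>c\<close> and \<open>d\<close> are the coefficients of order 1 and 2 of the
  Schwarz function, while 2t and 4t^2 - 1 are the Chebyshev values U_1(t) and U_2(t). The bound is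
  recorded for \<open>d\<close>, since \<open>c\<close> is later eliminated in favour of
  a(2).\<close>

lemma subordinate_H_coeffs:
  assumes sub: "subordinate F (\<lambda>z. H z t)" and exp: "F has_fps_expansion P"
  obtains c d where "norm d \<le> 1"
    and "fps_nth P 1 = 2 * of_real t * c"
    and "fps_nth P 2 = 2 * of_real t * d + (4 * (of_real t)\<^sup>2 - 1) * c\<^sup>2"
proof -
  obtain \<omega> where \<omega>: "\<omega> holomorphic_on unit_disk" "\<omega> 0 = 0"
      "\<And>z. z \<in> unit_disk \<Longrightarrow> norm (\<omega> z) < 1"
      "\<And>z. z \<in> unit_disk \<Longrightarrow> F z = H (\<omega> z) t"
    using sub unfolding subordinate_def by blast
  define W where "W = fps_expansion \<omega> 0"
  have W: "\<omega> has_fps_expansion W"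
    unfolding W_def using \<omega>(1) by (intro has_fps_expansion_fps_expansion[of unit_disk]) auto
  have W0: "fps_nth W 0 = 0"
    using has_fps_expansion_imp_0_eq_fps_nth_0[OF W] \<omega>(2) by simp
  define Q where "Q = 1 - fps_const (2 * of_real t) * W + W ^ 2"
  have Q0: "fps_nth Q 0 = 1"
    using W0 by (simp add: Q_def)
  have "(\<lambda>z. inverse (1 - 2 * of_real t * \<omega> z + \<omega> z ^ 2)) has_fps_expansion inverse Q"
    using Q0 unfolding Q_def by (intro fps_expansion_intros W) auto
  also have "?this \<longleftrightarrow> F has_fps_expansion inverse Q"
  proof (rule has_fps_expansion_cong)
    have "eventually (\<lambda>z::complex. z \<in> unit_disk) (nhds 0)"
      by (rule eventually_nhds_in_open) auto
    then show "eventually (\<lambda>z. inverse (1 - 2 * of_real t * \<omega> z + \<omega> z ^ 2) = F z) (nhds 0)"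
      by eventually_elim (simp add: \<omega>(4) H_def divide_inverse)
  qed simp
  finally have "P = inverse Q"
    using exp fps_expansion_unique_complex by blast
  \<comment> \<open>In this form the coefficients of \<open>P\<close> follow one after another from
    those of \<open>Q\<close>, by comparing orders 0, 1 and 2.\<close>
  then have PQ: "P * Q = 1"
    using Q0 by (simp add: inverse_mult_eq_1)
  have P0: "fps_nth P 0 = 1"
    using arg_cong[OF PQ, of "\<lambda>p. fps_nth p 0"] Q0 by simp
  have Q1: "fps_nth Q 1 = - 2 * of_real t * fps_nth W 1"
    using W0 by (simp add: Q_def power2_eq_square fps_mult_nth)
  have Q2: "fps_nth Q 2 = - 2 * of_real t * fps_nth W 2 + (fps_nth W 1)\<^sup>2"
    using W0 by (simp add: Q_def power2_eq_square fps_mult_nth numeral_2_eq_2)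
  have P1: "fps_nth P 1 = 2 * of_real t * fps_nth W 1"
    using arg_cong[OF PQ, of "\<lambda>p. fps_nth p 1"] P0 Q0 Q1 by (simp add: fps_mult_nth)
  have "fps_nth P 2 + fps_nth P 1 * fps_nth Q 1 + fps_nth Q 2 = 0"
    using arg_cong[OF PQ, of "\<lambda>p. fps_nth p 2"] P0 Q0
    by (simp add: fps_mult_nth numeral_2_eq_2 add_ac)
  then have "fps_nth P 2 = - (fps_nth P 1 * fps_nth Q 1) - fps_nth Q 2"
    by (simp add: algebra_simps eq_neg_iff_add_eq_0)
  then have "fps_nth P 2 = 2 * of_real t * fps_nth W 2 + (4 * (of_real t)\<^sup>2 - 1) * (fps_nth W 1)\<^sup>2"
    unfolding P1 Q1 Q2 by (simp add: power2_eq_square algebra_simps)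
  moreover have "norm (fps_nth W 2) \<le> 1"
    using \<omega>(1) less_imp_le[OF \<omega>(3)] W by (rule bounded_imp_fps_nth_le_1)
  ultimately show thesis
    using P1 that by blast
qed

lemma B_operator_has_fps_expansion:
  assumes "f has_fps_expansion P" "fps_nth P 0 = 0" "fps_nth P 1 = 1"
  shows "B_operator lam mu f has_fps_expansion
    fps_const (1 - of_real lam) * fps_shift 1 P + fps_const (of_real lam) * fps_deriv P
      + fps_const (of_real mu) * fps_X * fps_deriv (fps_deriv P)"
proof -
  have "P \<noteq> 0"
    using assms(3) by auto
  then have "1 \<le> subdegree P"
    using assms(2) by (intro subdegree_geI) auto
  \<comment> \<open>Dividing by z shifts the series by one place. The value 1 that
    \<open>quotient_id\<close> takes at 0 is the right one because the linear coefficient of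
    \<open>P\<close> is 1.\<close>
  then have "quotient_id f has_fps_expansion fps_shift 1 P"
    using has_fps_expansion_shift[OF assms(1), of 1 1] assms(3)
    unfolding quotient_id_def[abs_def] power_one_right by simp
  then show ?thesis
    unfolding B_operator_def[abs_def] using assms(1) by (intro fps_expansion_intros)
qed

text \<open>The operator multiplies the coefficient of order n + 1 by (1 - lam) + lam (n + 1) + mu n
  (n + 1) = 1 + n lam + n (n + 1) mu and moves it to order n. The cases n = 1 and n = 2 give the two
  factors below.\<close>

lemma subordinate_B_operator_coeffs:
  assumes sub: "subordinate (B_operator lam mu f) (\<lambda>z. H z t)"
    and P: "f has_fps_expansion P" "fps_nth P 0 = 0" "fps_nth P 1 = 1"
  obtains c d where "norm d \<le> 1"
    and "of_real (1 + lam + 2 * mu) * fps_nth P 2 = 2 * of_real t * c"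
    and "of_real (1 + 2 * lam + 6 * mu) * fps_nth P 3
           = 2 * of_real t * d + (4 * (of_real t)\<^sup>2 - 1) * c\<^sup>2"
proof (rule subordinate_H_coeffs[OF sub B_operator_has_fps_expansion[OF P]])
  fix c d
  assume *: "norm d \<le> 1"
    "(fps_const (1 - of_real lam) * fps_shift 1 P + fps_const (of_real lam) * fps_deriv P
      + fps_const (of_real mu) * fps_X * fps_deriv (fps_deriv P)) $ 1 = 2 * of_real t * c"
    "(fps_const (1 - of_real lam) * fps_shift 1 P + fps_const (of_real lam) * fps_deriv P
      + fps_const (of_real mu) * fps_X * fps_deriv (fps_deriv P)) $ 2
        = 2 * of_real t * d + (4 * (of_real t)\<^sup>2 - 1) * c\<^sup>2"
  show thesis
  proof (rule that)
    show "norm d \<le> 1" by fact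
    show "of_real (1 + lam + 2 * mu) * fps_nth P 2 = 2 * of_real t * c"
      using *(2) by (simp add: mult.assoc numeral_2_eq_2 algebra_simps)
    show "of_real (1 + 2 * lam + 6 * mu) * fps_nth P 3
           = 2 * of_real t * d + (4 * (of_real t)\<^sup>2 - 1) * c\<^sup>2"
      using *(3) by (simp add: mult.assoc numeral_2_eq_2 numeral_3_eq_3 algebra_simps)
  qed
qed

lemma normalized_expansion_has_fps_expansion:
  assumes "has_normalized_expansion f a"
  shows "f has_fps_expansion (fps_X + fps_X ^ 2 * Abs_fps (\<lambda>n. a (n + 2)))"
proof -
  have "(\<lambda>z. f z - z) has_fps_expansion (fps_X ^ 2 * Abs_fps (\<lambda>n. a (n + 2)))"
  proof (rule has_fps_expansionI)
    have "eventually (\<lambda>z::complex. z \<in> unit_disk) (nhds 0)"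
      by (rule eventually_nhds_in_open) auto
    then show "eventually (\<lambda>z. (\<lambda>n. fps_nth (fps_X ^ 2 * Abs_fps (\<lambda>n. a (n + 2))) n * z ^ n)
        sums (f z - z)) (nhds 0)"
    proof eventually_elim
      case (elim z)
      then have "(\<lambda>n. a (n + 2) * z ^ (n + 2)) sums (f z - z)"
        using assms by (simp add: has_normalized_expansion_def)
      then have "(\<lambda>n. fps_nth (fps_X ^ 2 * Abs_fps (\<lambda>n. a (n + 2))) (n + 2) * z ^ (n + 2))
          sums (f z - z)"
        by (simp add: fps_X_power_mult_nth)
      \<comment> \<open>The factor \<open>fps_X ^ 2\<close> makes the coefficients of order 0 and 1
        vanish, so the sum may start at 0 instead of 2.\<close>
      then show ?case
        by (rule sums_zero_iff_shift[THEN iffD1, rotated]) (auto simp: fps_X_power_mult_nth)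
    qed
  qed
  from has_fps_expansion_add[OF has_fps_expansion_fps_X this] show ?thesis
    by simp
qed

text \<open>Near 0 the function \<open>g\<close> is a left inverse of \<open>f\<close>, so
  \<open>G oo P = fps_X\<close>. As the linear coefficient of \<open>P\<close> is 1, this system is
  triangular with unit diagonal, and orders 0 to 3 are solved successively.\<close>

lemma inverse_extension_coeffs:
  assumes inv: "inverse_extension f g"
    and P: "f has_fps_expansion P" "fps_nth P 0 = 0" "fps_nth P 1 = 1"
  obtains G where "g has_fps_expansion G" "fps_nth G 0 = 0" "fps_nth G 1 = 1"
    "fps_nth G 2 = - fps_nth P 2" "fps_nth G 3 = 2 * (fps_nth P 2)\<^sup>2 - fps_nth P 3"
proof -
  obtain V W where g: "g holomorphic_on unit_disk" and V: "open V" "0 \<in> V"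
      and hom: "homeomorphism V W f g"
    using inv unfolding inverse_extension_def by blast
  define G where "G = fps_expansion g 0"
  have G: "g has_fps_expansion G"
    unfolding G_def using g by (intro has_fps_expansion_fps_expansion[of unit_disk]) auto
  have "(g \<circ> f) has_fps_expansion (G oo P)"
    using G P by (intro has_fps_expansion_compose)
  also have "?this \<longleftrightarrow> (\<lambda>z. z) has_fps_expansion (G oo P)"
  proof (rule has_fps_expansion_cong)
    show "eventually (\<lambda>z. (g \<circ> f) z = z) (nhds 0)"
      using eventually_nhds_in_open[OF V]
      by eventually_elim (use hom in \<open>simp add: homeomorphism_apply1\<close>)
  qed simp
  finally have GP: "G oo P = fps_X"
    using has_fps_expansion_fps_X fps_expansion_unique_complex by blast
  have G0: "fps_nth G 0 = 0"
    using arg_cong[OF GP, of "\<lambda>p. fps_nth p 0"] by (simp add: fps_compose_nth)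
  have G1: "fps_nth G 1 = 1"
    using arg_cong[OF GP, of "\<lambda>p. fps_nth p 1"] P(3) by (simp add: fps_compose_nth G0)
  have G2: "fps_nth G 2 = - fps_nth P 2"
    using arg_cong[OF GP, of "\<lambda>p. fps_nth p 2"] P(2,3) G0 G1
    by (simp add: fps_compose_nth fps_mult_nth power2_eq_square numeral_2_eq_2
        eq_neg_iff_add_eq_0 add.commute)
  have G3: "fps_nth G 3 = 2 * (fps_nth P 2)\<^sup>2 - fps_nth P 3"
    using arg_cong[OF GP, of "\<lambda>p. fps_nth p 3"] P(2,3) G0 G1 G2
    by (simp add: fps_compose_nth fps_mult_nth power2_eq_square numeral_2_eq_2 numeral_3_eq_3
        algebra_simps)
  show thesis
    using that G G0 G1 G2 G3 by blast
qed

text \<open>Regrouping by \<open>c\<close> and \<open>d\<close> before taking norms is what produces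
  a maximum; estimating \<open>c + d\<close> and \<open>c - d\<close> separately would only give 2
  (|x| + |y|).\<close>

lemma norm_add_diff_mult_le:
  fixes c d :: complex and x y :: real
  assumes "norm c \<le> 1" "norm d \<le> 1"
  shows "norm (of_real x * (c + d) + of_real y * (c - d)) \<le> 2 * max \<bar>x\<bar> \<bar>y\<bar>"
proof -
  have "of_real x * (c + d) + of_real y * (c - d) = of_real (x + y) * c + of_real (x - y) * d"
    by (simp add: algebra_simps)
  also have "norm \<dots> \<le> \<bar>x + y\<bar> * norm c + \<bar>x - y\<bar> * norm d"
    by (rule norm_triangle_mono) (simp_all add: norm_mult del: of_real_add of_real_diff)
  also have "\<dots> \<le> \<bar>x + y\<bar> * 1 + \<bar>x - y\<bar> * 1"
    using assms by (intro add_mono mult_left_mono) auto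
  also have "\<dots> \<le> 2 * max \<bar>x\<bar> \<bar>y\<bar>"
    by (simp add: max_def abs_if)
  finally show ?thesis .
qed

theorem theorem4p1:
  fixes lam mu t \<eta> :: real and f :: "complex \<Rightarrow> complex" and a :: "nat \<Rightarrow> complex"
  assumes "lam \<ge> 1" and "mu \<ge> 0" and "1/2 < t" and "t < 1"
    and "f \<in> class_B_Sigma lam mu t"
    and "has_normalized_expansion f a"
  shows "let D = \<bar>(1 + lam + 2 * mu)\<^sup>2 - 4 * t\<^sup>2 * ((lam + 2 * mu)\<^sup>2 - 2 * mu)\<bar>;
             M = D / (4 * (1 + 2 * lam + 6 * mu) * t\<^sup>2)
         in (\<bar>\<eta> - 1\<bar> \<le> M \<longrightarrow>
               norm (a 3 - of_real \<eta> * (a 2)\<^sup>2) \<le> 2 * t / (1 + 2 * lam + 6 * mu)) \<and>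
            (\<bar>\<eta> - 1\<bar> \<ge> M \<and> D \<noteq> 0 \<longrightarrow>
               norm (a 3 - of_real \<eta> * (a 2)\<^sup>2) \<le> 8 * \<bar>\<eta> - 1\<bar> * t ^ 3 / D)"
proof -
  \<comment> \<open>\<open>A\<close> and \<open>B\<close> are the factors of the operator at orders
    1 and 2; \<open>E\<close> is the denominator of the theorem without its modulus.\<close>
  define A B E where "A = 1 + lam + 2 * mu" and "B = 1 + 2 * lam + 6 * mu"
    and "E = (1 + lam + 2 * mu)\<^sup>2 - 4 * t\<^sup>2 * ((lam + 2 * mu)\<^sup>2 - 2 * mu)"
  have pos: "A > 0" "B > 0" "t > 0"
    using assms(1-3) by (auto simp: A_def B_def)
  \<comment> \<open>The reason is that (lam + 2 mu)^2 - 2 mu = A^2 - B. In this form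
    \<open>E\<close> arises below as the factor of a(2)^2.\<close>
  have E_eq: "E = 4 * t\<^sup>2 * B - (4 * t\<^sup>2 - 1) * A\<^sup>2"
    by (simp add: A_def B_def E_def power2_eq_square algebra_simps)
  define P where "P = fps_X + fps_X ^ 2 * Abs_fps (\<lambda>n. a (n + 2))"
  have P: "f has_fps_expansion P"
    unfolding P_def using assms(6) by (rule normalized_expansion_has_fps_expansion)
  have P_nth: "fps_nth P 0 = 0" "fps_nth P 1 = 1" "fps_nth P 2 = a 2" "fps_nth P 3 = a 3"
    by (simp_all add: P_def fps_X_power_mult_nth) (simp_all add: numeral_2_eq_2 numeral_3_eq_3)
  obtain g where g: "inverse_extension f g"
      and sub_f: "subordinate (B_operator lam mu f) (\<lambda>z. H z t)"
      and sub_g: "subordinate (B_operator lam mu g) (\<lambda>w. H w t)"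
    using assms(5) unfolding class_B_Sigma_def by blast
  obtain G where G: "g has_fps_expansion G" "fps_nth G 0 = 0" "fps_nth G 1 = 1"
      "fps_nth G 2 = - a 2" "fps_nth G 3 = 2 * (a 2)\<^sup>2 - a 3"
    using inverse_extension_coeffs[OF g P P_nth(1,2)] P_nth(3,4) by metis
  obtain c\<^sub>1 c where c: "norm c \<le> 1" "of_real A * a 2 = 2 * of_real t * c\<^sub>1"
      "of_real B * a 3 = 2 * of_real t * c + (4 * (of_real t)\<^sup>2 - 1) * c\<^sub>1\<^sup>2"
    using subordinate_B_operator_coeffs[OF sub_f P P_nth(1,2)] P_nth(3,4)
    unfolding A_def B_def by metis
  obtain d\<^sub>1 d where d: "norm d \<le> 1" "of_real A * (- a 2) = 2 * of_real t * d\<^sub>1"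
      "of_real B * (2 * (a 2)\<^sup>2 - a 3) = 2 * of_real t * d + (4 * (of_real t)\<^sup>2 - 1) * d\<^sub>1\<^sup>2"
    using subordinate_B_operator_coeffs[OF sub_g G(1-3)] G(4,5)
    unfolding A_def B_def by metis
  have "2 * of_real t * d\<^sub>1 = 2 * of_real t * (- c\<^sub>1)"
    using c(2) d(2) by simp
  then have d1: "d\<^sub>1 = - c\<^sub>1"
    using pos by (subst (asm) mult_left_cancel) auto
  have diff: "of_real B * (a 3 - (a 2)\<^sup>2) = of_real t * (c - d)"
    using c(3) d(3) unfolding d1 by algebra
  have "of_real B * (a 2)\<^sup>2 = of_real t * (c + d) + (4 * (of_real t)\<^sup>2 - 1) * c\<^sub>1\<^sup>2"
    using c(3) d(3) unfolding d1 by algebra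
  \<comment> \<open>The factor 4t^2 turns c_1^2 into (2t c_1)^2, which equals (A a(2))^2 by the
    equation of order 1.\<close>
  then have "4 * (of_real t)\<^sup>2 * (of_real B * (a 2)\<^sup>2)
      = 4 * (of_real t)\<^sup>2 * (of_real t * (c + d)) + (4 * (of_real t)\<^sup>2 - 1) * (2 * of_real t * c\<^sub>1)\<^sup>2"
    by algebra
  then have sum: "of_real E * (a 2)\<^sup>2 = of_real (4 * t ^ 3) * (c + d)"
    unfolding c(2)[symmetric] E_eq
    by (simp add: power2_eq_square power3_eq_cube algebra_simps)
  have decomp: "a 3 - of_real \<eta> * (a 2)\<^sup>2
      = of_real (1 - \<eta>) * (a 2)\<^sup>2 + of_real (t / B) * (c - d)"
    using diff pos by (simp add: field_simps)
  \<comment> \<open>For \<eta> = 1 the term with a(2)^2 disappears, and the first argument of the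
    maximum is 0 even if \<open>E = 0\<close>, because division by zero yields 0.\<close>
  have bound: "norm (a 3 - of_real \<eta> * (a 2)\<^sup>2) \<le> 2 * max (4 * \<bar>\<eta> - 1\<bar> * t ^ 3 / \<bar>E\<bar>) (t / B)"
    if "E \<noteq> 0 \<or> \<eta> = 1"
  proof -
    have "of_real (1 - \<eta>) * (a 2)\<^sup>2 = of_real ((1 - \<eta>) * (4 * t ^ 3) / E) * (c + d)"
    proof (cases "\<eta> = 1")
      case False
      with that have "(a 2)\<^sup>2 = of_real (4 * t ^ 3) * (c + d) / of_real E"
        using sum by (simp add: eq_divide_eq mult.commute)
      then show ?thesis by simp
    qed simp
    with decomp norm_add_diff_mult_le[OF c(1) d(1), of "(1 - \<eta>) * (4 * t ^ 3) / E" "t / B"]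
    show ?thesis
      using pos by (simp add: abs_mult abs_minus_commute mult_ac)
  qed
  \<comment> \<open>The threshold M is the value of |\<eta> - 1| at which the two arguments of the
    maximum coincide.\<close>
  have iff: "\<bar>\<eta> - 1\<bar> \<le> \<bar>E\<bar> / (4 * B * t\<^sup>2) \<longleftrightarrow> 4 * \<bar>\<eta> - 1\<bar> * t ^ 3 / \<bar>E\<bar> \<le> t / B"
    if "E \<noteq> 0"
  proof -
    have "4 * \<bar>\<eta> - 1\<bar> * t ^ 3 / \<bar>E\<bar> \<le> t / B \<longleftrightarrow> t * (\<bar>\<eta> - 1\<bar> * (4 * B * t\<^sup>2)) \<le> t * \<bar>E\<bar>"
      using pos that by (simp add: field_simps power2_eq_square power3_eq_cube)
    then show ?thesis
      using pos by (simp add: pos_le_divide_eq mult.assoc)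
  qed
  have "norm (a 3 - of_real \<eta> * (a 2)\<^sup>2) \<le> 2 * t / B" if "\<bar>\<eta> - 1\<bar> \<le> \<bar>E\<bar> / (4 * B * t\<^sup>2)"
  proof (cases "E = 0")
    case True
    then have "\<eta> = 1" using that by simp
    then show ?thesis using bound pos True by simp
  next
    case False
    then show ?thesis using bound iff that by (simp add: max_def)
  qed
  moreover have "norm (a 3 - of_real \<eta> * (a 2)\<^sup>2) \<le> 8 * \<bar>\<eta> - 1\<bar> * t ^ 3 / \<bar>E\<bar>"
    if "\<bar>\<eta> - 1\<bar> \<ge> \<bar>E\<bar> / (4 * B * t\<^sup>2)" "E \<noteq> 0"
  proof -
    have "\<bar>\<eta> - 1\<bar> * t ^ 3 * 4 / \<bar>E\<bar> \<ge> t / B"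
      using that pos by (simp add: field_simps power2_eq_square power3_eq_cube)
    then show ?thesis using bound that by (simp add: max_def mult_ac split: if_splits)
  qed
  ultimately show ?thesis
    unfolding Let_def E_def B_def by auto
qed

end
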